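(* For every integer $M\ge2$, the speedup bound of global deadline-monotonic (DM) scheduling for arbitrary-deadline sporadic task systems on $M$ identical processors is at least $3-\frac{3}{M+1}$; that is, every $s>0$ that is a speedup bound of global DM with respect to the optimal schedule satisfies $s\ge 3-\frac{3}{M+1}$.
   Context: Model. A sporadic task $\tau_i$ has worst-case execution time $C_i>0$ (on a speed-1 processor), minimum inter-arrival time $T_i>0$ ($T_i=\infty$ allowed, meaning a single job), relative deadline $D_i>0$ and utilization $U_i=C_i/T_i$; it is assumed that $C_i\le D_i$ and $U_i\le1$, with no relation required between $D_i$ and $T_i$ (arbitrary deadlines). Task $\tau_i$ releases a sequence of jobs whose consecutive arrivals are at least $T_i$ apart; a job arriving at $t$ must finish by its absolute deadline $t+D_i$. On processors of speed $s$, each job of $\tau_i$ needs at most $C_i/s$ time units of execution. Preemption and migration cost nothing. At any instant at most one job of each task executes, on at most one processor. A finite task set can be feasibly scheduled on $M$ processors of a given speed if, for every legal job arrival sequence, some multiprocessor schedule meets all deadlines. Global DM is global fixed-priority preemptive scheduling in which tasks with smaller relative deadline have higher priority (ties broken arbitrarily but fixed, giving unique priorities): at each instant, among the tasks having an arrived and unfinished job, the $M$ highest-priority ones (all of them if fewer than $M$) execute; jobs of one task are executed in arrival order. A scheduling algorithm has speedup bound $s$ (with respect to the optimal schedule) if it meets all deadlines of every task set on $M$ processors of speed $s$ whenever that task set can be feasibly scheduled on $M$ processors of speed $1$. *)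

theory Defs
  imports "HOL-Analysis.Analysis" "HOL-Library.Extended_Nat" "HOL-Library.Extended_Real"
begin

record task =
  wcet :: real       \<comment> \<open>on a processor of speed 1\<close>
  period :: ereal    \<comment> \<open>minimum inter-arrival time; infinite for a task with at most one job\<close>
  deadline :: real   \<comment> \<open>relative\<close>

definition utilization :: "task \<Rightarrow> ereal" where
  "utilization x = ereal (wcet x) / period x"

definition sporadic_task :: "task \<Rightarrow> bool" where
  "sporadic_task x \<longleftrightarrow>
     0 < wcet x \<and> 0 < period x \<and> 0 < deadline x \<and> wcet x \<le> deadline x \<and> utilization x \<le> 1"

text \<open>A finite task set is a list, so that tasks with equal parameters stay distinct; a task is
  referred to by its index. The pair \<open>(i, k)\<close> denotes the \<open>k\<close>-th job of task \<open>i\<close>.\<close>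

definition task_system :: "task list \<Rightarrow> bool" where
  "task_system ts \<longleftrightarrow> (\<forall>x \<in> set ts. sporadic_task x)"

type_synonym job = "nat \<times> nat"

text \<open>One run of the system: how many jobs each task releases (possibly infinitely many), when they
  arrive, and how many time units of execution each of them actually needs.\<close>

record job_sequence =
  num_jobs :: "nat \<Rightarrow> enat"
  arrival :: "job \<Rightarrow> real"
  exec_time :: "job \<Rightarrow> real"

definition jobs :: "task list \<Rightarrow> job_sequence \<Rightarrow> job set" where
  "jobs ts J = {(i, k). i < length ts \<and> enat k < num_jobs J i}"

text \<open>Legality on processors of speed \<open>s\<close>. Time starts at 0. For an infinite period the separation
  condition is unsatisfiable, so that such a task has at most one job.\<close>

definition legal :: "real \<Rightarrow> task list \<Rightarrow> job_sequence \<Rightarrow> bool" where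
  "legal s ts J \<longleftrightarrow>
     (\<forall>(i, k) \<in> jobs ts J. 0 \<le> arrival J (i, k) \<and>
        0 \<le> exec_time J (i, k) \<and> exec_time J (i, k) \<le> wcet (ts ! i) / s) \<and>
     (\<forall>i k. (i, Suc k) \<in> jobs ts J \<longrightarrow>
        ereal (arrival J (i, k)) + period (ts ! i) \<le> ereal (arrival J (i, Suc k)))"

text \<open>\<open>\<sigma> p t\<close> is the job executing on processor \<open>p\<close> at time \<open>t\<close>, if any; only processors
  \<open>p < M\<close> and times \<open>t \<ge> 0\<close> matter.\<close>

type_synonym schedule = "nat \<Rightarrow> real \<Rightarrow> job option"

definition executing :: "nat \<Rightarrow> schedule \<Rightarrow> real \<Rightarrow> job set" where
  "executing M \<sigma> t = {j. \<exists>p<M. \<sigma> p t = Some j}"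

text \<open>Execution time received in \<open>[0, t)\<close>.\<close>

definition service :: "nat \<Rightarrow> schedule \<Rightarrow> job \<Rightarrow> real \<Rightarrow> real" where
  "service M \<sigma> j t = measure lebesgue {u \<in> {0..<t}. j \<in> executing M \<sigma> u}"

definition pending :: "nat \<Rightarrow> task list \<Rightarrow> job_sequence \<Rightarrow> schedule \<Rightarrow> real \<Rightarrow> job set" where
  "pending M ts J \<sigma> t =
     {j \<in> jobs ts J. arrival J j \<le> t \<and> service M \<sigma> j t < exec_time J j}"

text \<open>Preemption and migration are free and unrestricted, except that the execution times have to be
  measurable for \<^const>\<open>service\<close> to be meaningful.\<close>

definition valid_schedule :: "nat \<Rightarrow> task list \<Rightarrow> job_sequence \<Rightarrow> schedule \<Rightarrow> bool" where
  "valid_schedule M ts J \<sigma> \<longleftrightarrow>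
     (\<forall>j. {u \<in> {0..}. j \<in> executing M \<sigma> u} \<in> sets lebesgue) \<and>
     (\<forall>t\<ge>0. executing M \<sigma> t \<subseteq> pending M ts J \<sigma> t) \<and>
     (\<forall>t\<ge>0. \<forall>p<M. \<forall>q<M. \<forall>i k l.
        \<sigma> p t = Some (i, k) \<longrightarrow> \<sigma> q t = Some (i, l) \<longrightarrow> p = q)"

definition meets_deadlines :: "nat \<Rightarrow> task list \<Rightarrow> job_sequence \<Rightarrow> schedule \<Rightarrow> bool" where
  "meets_deadlines M ts J \<sigma> \<longleftrightarrow>
     (\<forall>(i, k) \<in> jobs ts J.
        service M \<sigma> (i, k) (arrival J (i, k) + deadline (ts ! i)) \<ge> exec_time J (i, k))"

definition feasible :: "nat \<Rightarrow> real \<Rightarrow> task list \<Rightarrow> bool" where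
  "feasible M s ts \<longleftrightarrow>
     (\<forall>J. legal s ts J \<longrightarrow> (\<exists>\<sigma>. valid_schedule M ts J \<sigma> \<and> meets_deadlines M ts J \<sigma>))"

text \<open>A scheduling algorithm is given by the schedules it may produce on \<open>M\<close> processors. The processor
  speed enters only through the execution times.\<close>

type_synonym algorithm = "nat \<Rightarrow> task list \<Rightarrow> job_sequence \<Rightarrow> schedule \<Rightarrow> bool"

definition speedup_bound :: "nat \<Rightarrow> algorithm \<Rightarrow> real \<Rightarrow> bool" where
  "speedup_bound M A s \<longleftrightarrow>
     (\<forall>ts. task_system ts \<longrightarrow> feasible M 1 ts \<longrightarrow>
        (\<forall>J \<sigma>. legal s ts J \<longrightarrow> A M ts J \<sigma> \<longrightarrow> meets_deadlines M ts J \<sigma>))"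

definition active_tasks :: "nat \<Rightarrow> task list \<Rightarrow> job_sequence \<Rightarrow> schedule \<Rightarrow> real \<Rightarrow> nat set" where
  "active_tasks M ts J \<sigma> t = fst ` pending M ts J \<sigma> t"

text \<open>Priorities are numbers, smaller ones being higher priorities. A tie-breaking rule fixes them for
  every task set, independently of the arriving jobs.\<close>

definition dm_priorities :: "(task list \<Rightarrow> nat \<Rightarrow> nat) \<Rightarrow> bool" where
  "dm_priorities \<pi> \<longleftrightarrow>
     (\<forall>ts. inj_on (\<pi> ts) {..<length ts} \<and>
        (\<forall>i<length ts. \<forall>j<length ts. deadline (ts ! i) < deadline (ts ! j) \<longrightarrow> \<pi> ts i < \<pi> ts j))"

text \<open>Every active task among the \<open>M\<close> highest-priority active ones executes its earliest unfinished job,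
  and nothing else executes.\<close>

definition global_fp :: "(task list \<Rightarrow> nat \<Rightarrow> nat) \<Rightarrow> algorithm" where
  "global_fp \<pi> M ts J \<sigma> \<longleftrightarrow>
     valid_schedule M ts J \<sigma> \<and>
     (\<forall>t\<ge>0. executing M \<sigma> t =
        {(i, k). i \<in> active_tasks M ts J \<sigma> t \<and>
           card {h \<in> active_tasks M ts J \<sigma> t. \<pi> ts h < \<pi> ts i} < M \<and>
           k = (LEAST l. (i, l) \<in> pending M ts J \<sigma> t)})"

end

theory Submission imports Defs begin

text \<open>The bad task system consists of \<open>M\<close> tasks with period and execution time 1 but deadline about
  \<open>4 M\<close>, of \<open>M\<close> single jobs of length about \<open>4 M\<close>, and of one last job of length \<open>4 M\<close> and deadline
  \<open>4 (M + 1)\<close>. It is feasible at speed 1: the last job runs as soon as it arrives, migrating to another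
  processor every 4 time units, so that it takes only 4 time units from each processor. Each
  processor serves one periodic task and one single job besides; the single job and the slice of the last
  job delay the periodic task by a bounded amount in total, which its long deadline absorbs. Under
  global DM, if all jobs arrive synchronously, the periodic tasks occupy all processors for a fraction \<open>1 / s\<close> of the time, and
  the single jobs occupy all processors in the remaining gaps until they are finished. The time left for
  the last job before its deadline is too short if \<open>s < 3 M / (M + 1)\<close>.\<close>

section \<open>Available time of a set, read as a clock\<close>

definition avail :: "real set \<Rightarrow> real \<Rightarrow> real" where
  "avail A t = measure lebesgue (A \<inter> {0..<t})"

text \<open>A job arriving at \<open>a\<close> that executes during \<open>window A a e\<close> is never
  early, since \<open>avail A t \<le> t\<close>, and late by at most the measure of the complement of \<open>A\<close>.
  Windows of jobs whose arrivals are at least \<open>e\<close> apart are disjoint, so no queue has to be modelled.\<close>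

definition window :: "real set \<Rightarrow> real \<Rightarrow> real \<Rightarrow> real set" where
  "window A a e = {t \<in> A. a \<le> avail A t \<and> avail A t < a + e}"

lemma lmeasurable_Int_interval:
  assumes "A \<in> sets lebesgue"
  shows "A \<inter> {x..<y::real} \<in> lmeasurable"
  by (rule bounded_set_imp_lmeasurable) (use assms in \<open>auto intro: bounded_Int[THEN disjI2]\<close>)

lemma avail_zero [simp]: "avail A 0 = 0"
  by (simp add: avail_def)

lemma avail_nonneg [simp]: "0 \<le> avail A t"
  by (simp add: avail_def)

lemma avail_diff:
  assumes "A \<in> sets lebesgue" "B \<in> sets lebesgue" "B \<subseteq> A"
  shows "avail (A - B) t = avail A t - avail B t"
proof -
  have "(A - B) \<inter> {0..<t} = A \<inter> {0..<t} - B \<inter> {0..<t}" by auto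
  then show ?thesis
    unfolding avail_def using assms
    by (simp only:) (rule measurable_measure_Diff, auto intro: lmeasurable_Int_interval fmeasurableD)
qed

lemma avail_split:
  assumes "A \<in> sets lebesgue" "0 \<le> t" "t \<le> t'"
  shows "avail A t' = avail A t + measure lebesgue (A \<inter> {t..<t'})"
proof -
  have "A \<inter> {0..<t'} = (A \<inter> {0..<t}) \<union> (A \<inter> {t..<t'})" using assms by auto
  moreover have "measure lebesgue ((A \<inter> {0..<t}) \<union> (A \<inter> {t..<t'}))
     = measure lebesgue (A \<inter> {0..<t}) + measure lebesgue (A \<inter> {t..<t'})"
    by (rule measure_Un_AE) (use assms lmeasurable_Int_interval in auto)
  ultimately show ?thesis by (simp add: avail_def)
qed

lemma avail_increase:
  assumes "A \<in> sets lebesgue" "0 \<le> t" "t \<le> t'"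
  shows "avail A t \<le> avail A t'" "avail A t' \<le> avail A t + (t' - t)"
proof -
  show "avail A t \<le> avail A t'" by (simp add: avail_split[OF assms])
  have "measure lebesgue (A \<inter> {t..<t'}) \<le> measure lebesgue {t..<t'}"
    by (rule measure_mono_fmeasurable) (use assms lmeasurable_Int_interval[of UNIV] in \<open>auto intro: fmeasurableD lmeasurable_Int_interval\<close>)
  then show "avail A t' \<le> avail A t + (t' - t)" using assms by (simp add: avail_split[OF assms])
qed

lemma avail_le:
  assumes "A \<in> sets lebesgue" "0 \<le> t"
  shows "avail A t \<le> t"
  using avail_increase(2)[OF assms(1) order_refl assms(2)] by simp

lemma avail_UNIV:
  assumes "0 \<le> t"
  shows "avail {0..} t = t"
proof -
  have "{0..} \<inter> {0..<t} = {0..<t}" by auto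
  then show ?thesis using assms by (simp add: avail_def)
qed

lemma continuous_on_avail:
  assumes "A \<in> sets lebesgue"
  shows "continuous_on {0..} (avail A)"
proof (rule lipschitz_on_continuous_on[of 1], rule lipschitz_onI)
  fix x y :: real
  assume "x \<in> {0..}" "y \<in> {0..}"
  then show "dist (avail A x) (avail A y) \<le> 1 * dist x y"
    using avail_increase[OF assms, of x y] avail_increase[OF assms, of y x]
    by (cases "x \<le> y") (auto simp: dist_real_def)
qed simp

lemma sets_avail_less:
  assumes "A \<in> sets lebesgue" "A \<subseteq> {0..}"
  shows "{t \<in> A. avail A t < c} \<in> sets lebesgue"
proof -
  have "closed ({0..} \<inter> avail A -` {c..})"
    by (intro continuous_closed_preimage continuous_on_avail assms closed_atLeast)
  then have "{0..} \<inter> avail A -` {c..} \<in> sets lebesgue"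
    by (metis borel_closed sets_completionI_sets sets_lborel)
  moreover have "{t \<in> A. avail A t < c} = A - ({0..} \<inter> avail A -` {c..})"
    using assms(2) by auto
  ultimately show ?thesis using assms(1) by simp
qed

text \<open>The clock \<open>avail A\<close> is continuous, monotone and starts at 0, so it attains
  every level \<open>c\<close> that it does not stay below up to time \<open>t\<close>. It may stand
  still at \<open>c\<close>, hence the compactness argument for the first such time: up to
  \<open>t\<close>, the set is \<open>A\<close> cut off there, and its measure is
  \<open>c\<close>.\<close>

lemma avail_avail_less:
  assumes A: "A \<in> sets lebesgue" "A \<subseteq> {0..}" and "0 \<le> c" "0 \<le> t"
  shows "avail {u \<in> A. avail A u < c} t = min (avail A t) c"
proof (cases "avail A t < c")
  case True
  then have "{u \<in> A. avail A u < c} \<inter> {0..<t} = A \<inter> {0..<t}"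
    using avail_increase(1)[OF A(1), of _ t] by (fastforce intro: le_less_trans)
  then show ?thesis using True by (simp add: avail_def)
next
  case False
  let ?K = "{0..t} \<inter> avail A -` {c}"
  have cont: "continuous_on {0..t} (avail A)"
    by (rule continuous_on_subset[OF continuous_on_avail[OF A(1)]]) auto
  have "compact ?K"
    using continuous_closed_preimage[OF cont] compact_Icc
    by (metis closed_atLeastAtMost closed_singleton compact_eq_bounded_closed bounded_Int)
  moreover have "?K \<noteq> {}"
    using IVT'[of "avail A" 0 c t] cont False assms by force
  ultimately obtain x where x: "x \<in> ?K" "\<And>y. y \<in> ?K \<Longrightarrow> x \<le> y"
    using compact_attains_inf by metis
  have "avail A u < c \<longleftrightarrow> u < x" if "0 \<le> u" "u < t" for u
  proof (cases "u < x")
    case True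
    then have "avail A u \<noteq> c" using x(2)[of u] that by auto
    then show ?thesis using True x(1) avail_increase(1)[OF A(1) that(1), of x] by auto
  next
    case False
    then show ?thesis using x(1) avail_increase(1)[OF A(1), of x u] by auto
  qed
  then have "{u \<in> A. avail A u < c} \<inter> {0..<t} = A \<inter> {0..<x}"
    using x(1) by auto
  then show ?thesis using False x(1) by (simp add: avail_def)
qed

lemma window_eq_Diff:
  assumes "0 \<le> e"
  shows "window A a e = {t \<in> A. avail A t < a + e} - {t \<in> A. avail A t < a}"
  using assms by (auto simp: window_def)

lemma sets_window:
  assumes "A \<in> sets lebesgue" "A \<subseteq> {0..}" "0 \<le> e"
  shows "window A a e \<in> sets lebesgue"
  unfolding window_eq_Diff[OF assms(3)] using assms by (auto intro: sets_avail_less)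

lemma avail_window:
  assumes "A \<in> sets lebesgue" "A \<subseteq> {0..}" "0 \<le> a" "0 \<le> e" "0 \<le> t"
  shows "avail (window A a e) t = min (avail A t) (a + e) - min (avail A t) a"
proof -
  have "{t \<in> A. avail A t < a} \<subseteq> {t \<in> A. avail A t < a + e}" using assms by auto
  then show ?thesis
    using assms by (simp add: window_eq_Diff avail_diff sets_avail_less avail_avail_less)
qed

lemma window_UNIV:
  assumes "0 \<le> a"
  shows "window {0..} a e = {a..<a + e}"
  using assms by (auto simp: window_def avail_UNIV)

section \<open>Schedules in which every job runs in its window\<close>

lemma service_eq_avail:
  assumes "\<And>u. 0 \<le> u \<Longrightarrow> j \<in> executing M \<sigma> u \<longleftrightarrow> u \<in> X"
  shows "service M \<sigma> j t = avail X t"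
proof -
  have "{u \<in> {0..<t}. j \<in> executing M \<sigma> u} = X \<inter> {0..<t}" using assms by auto
  then show ?thesis by (simp add: service_def avail_def)
qed

text \<open>A schedule can thus be specified by the condition under which a job occupies a
  processor; the only obligation is that no two jobs compete for it.\<close>

lemma schedule_of_relation:
  fixes R :: "nat \<Rightarrow> real \<Rightarrow> job \<Rightarrow> bool"
  assumes "\<And>p t j j'. R p t j \<Longrightarrow> R p t j' \<Longrightarrow> j = j'"
  obtains \<sigma> :: schedule where "\<And>p t j. \<sigma> p t = Some j \<longleftrightarrow> R p t j"
proof
  fix p t j
  show "(\<lambda>p t. if \<exists>j. R p t j then Some (THE j. R p t j) else None) p t = Some j \<longleftrightarrow> R p t j"
  proof (cases "\<exists>j. R p t j")
    case True
    then obtain j' where "R p t j'" by blast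
    moreover from this have "(THE j. R p t j) = j'" by (intro the_equality) (use assms in blast)+
    ultimately show ?thesis using assms[of p t j j'] True by (metis option.inject)
  next
    case False
    then show ?thesis by (metis option.distinct(1))
  qed
qed

text \<open>Shared by the feasible schedule and the DM schedule. The value \<open>start j\<close> is
  a reading of the clock \<open>avail (A j)\<close>, not a point in real time: service and
  pendingness become closed formulas in that reading, and a job that waits for another one on the
  same set simply gets a later reading.\<close>

locale window_schedule =
  fixes M :: nat and ts :: "task list" and J :: job_sequence and \<sigma> :: schedule
    and A :: "job \<Rightarrow> real set" and start :: "job \<Rightarrow> real"
  assumes executing_eq: "\<And>t. 0 \<le> t \<Longrightarrow>
      executing M \<sigma> t = {j \<in> jobs ts J. t \<in> window (A j) (start j) (exec_time J j)}"
    and sets_A: "\<And>j. j \<in> jobs ts J \<Longrightarrow> A j \<in> sets lebesgue"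
    and A_nonneg: "\<And>j. j \<in> jobs ts J \<Longrightarrow> A j \<subseteq> {0..}"
    and exec_nonneg: "\<And>j. j \<in> jobs ts J \<Longrightarrow> 0 \<le> exec_time J j"
    and start_nonneg: "\<And>j. j \<in> jobs ts J \<Longrightarrow> 0 \<le> start j"
    and arrival_le: "\<And>j. j \<in> jobs ts J \<Longrightarrow> arrival J j \<le> start j"
    and one_processor: "\<And>t p q i k l. \<lbrakk>0 \<le> t; p < M; q < M; \<sigma> p t = Some (i, k); \<sigma> q t = Some (i, l)\<rbrakk> \<Longrightarrow> p = q"
begin

lemma service_eq:
  assumes "j \<in> jobs ts J" "0 \<le> t"
  shows "service M \<sigma> j t = min (avail (A j) t) (start j + exec_time J j) - min (avail (A j) t) (start j)"
proof -
  have "service M \<sigma> j t = avail (window (A j) (start j) (exec_time J j)) t"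
    by (rule service_eq_avail) (use executing_eq assms in auto)
  then show ?thesis
    using assms by (simp add: avail_window sets_A A_nonneg start_nonneg exec_nonneg)
qed

lemma pending_eq:
  assumes "0 \<le> t"
  shows "pending M ts J \<sigma> t = {j \<in> jobs ts J. arrival J j \<le> t \<and>
    (0 < exec_time J j \<and> avail (A j) t < start j + exec_time J j)}"
proof -
  have "service M \<sigma> j t < exec_time J j \<longleftrightarrow> 0 < exec_time J j \<and> avail (A j) t < start j + exec_time J j"
    if "j \<in> jobs ts J" for j
    unfolding service_eq[OF that assms] using exec_nonneg[OF that] by (auto simp: min_def)
  then show ?thesis unfolding pending_def by blast
qed

lemma valid: "valid_schedule M ts J \<sigma>"
  unfolding valid_schedule_def
proof (intro conjI allI impI)
  fix j
  show "{u \<in> {0..}. j \<in> executing M \<sigma> u} \<in> sets lebesgue"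
  proof (cases "j \<in> jobs ts J")
    case True
    then have "{u \<in> {0..}. j \<in> executing M \<sigma> u} = window (A j) (start j) (exec_time J j)"
      using executing_eq A_nonneg[OF True] unfolding window_def by fastforce
    then show ?thesis using True by (simp add: sets_window sets_A A_nonneg exec_nonneg)
  next
    case False
    then have "{u \<in> {0..}. j \<in> executing M \<sigma> u} = {}" using executing_eq by auto
    then show ?thesis by (metis sets.empty_sets)
  qed
next
  fix t :: real assume t: "0 \<le> t"
  \<comment> \<open>The clock never runs ahead of real time, so a job whose start reading is reached
    has already arrived.\<close>
  have "arrival J j \<le> t" if "j \<in> jobs ts J" "start j \<le> avail (A j) t" for j
    using that arrival_le[of j] avail_le[OF sets_A, of j t] t by linarith
  then show "executing M \<sigma> t \<subseteq> pending M ts J \<sigma> t"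
    unfolding executing_eq[OF t] pending_eq[OF t] by (auto simp: window_def)
qed (use one_processor in blast)

end

text \<open>Only other members of \<open>H\<close> can outrank a member of \<open>H\<close>, so
  there are fewer than \<open>M\<close> of them, while all of \<open>H\<close> outranks a member of
  \<open>L\<close>. This replaces the counting in \<open>global_fp\<close> by membership in a group
  of tasks.\<close>

lemma card_higher_less_iff:
  fixes pri :: "nat \<Rightarrow> nat"
  assumes "finite H" "card H = M" "finite L" and less: "\<And>h l. h \<in> H \<Longrightarrow> l \<in> L \<Longrightarrow> pri h < pri l"
    and i: "i \<in> H \<union> L"
  shows "card {h \<in> H \<union> L. pri h < pri i} < M \<longleftrightarrow> i \<in> H"
proof (cases "i \<in> H")
  case True
  then have "{h \<in> H \<union> L. pri h < pri i} \<subset> H" using less by (auto dest: less_trans)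
  then show ?thesis using True assms psubset_card_mono by blast
next
  case False
  then have "H \<subseteq> {h \<in> H \<union> L. pri h < pri i}" using less i by auto
  then have "M \<le> card {h \<in> H \<union> L. pri h < pri i}" using assms card_mono[of "{h \<in> H \<union> L. pri h < pri i}" H] by simp
  then show ?thesis using False by simp
qed

lemma avail_interval_le:
  assumes "x \<le> y"
  shows "avail {x..<y} t \<le> y - x"
proof -
  have "avail {x..<y} t \<le> measure lebesgue {x..<y}"
    unfolding avail_def by (rule measure_mono_fmeasurable) (auto intro: bounded_set_imp_lmeasurable)
  then show ?thesis using assms by simp
qed

lemma avail_window_le:
  assumes "A \<in> sets lebesgue" "A \<subseteq> {0..}" "0 \<le> a" "0 \<le> e" "0 \<le> t"
  shows "avail (window A a e) t \<le> e"
  using assms by (simp add: avail_window min_def)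

text \<open>In each period all processors are blocked simultaneously by the first group of tasks, and then by
  the second group in the gaps. The deadlines differ only in order to make the priorities independent
  of the tie-breaking rule; the slack in the execution times pays for this.\<close>

definition dm_tasks :: "nat \<Rightarrow> task list" where
  "dm_tasks M =
     replicate M \<lparr>wcet = 1, period = 1, deadline = 4 * real M + 2\<rparr> @
     replicate M \<lparr>wcet = 4 * real M - 3, period = \<infinity>, deadline = 4 * real M + 3\<rparr> @
     [\<lparr>wcet = 4 * real M, period = \<infinity>, deadline = 4 * real M + 4\<rparr>]"

lemma length_dm_tasks [simp]: "length (dm_tasks M) = 2 * M + 1"
  by (simp add: dm_tasks_def)

lemma nth_dm_tasks:
  "i < M \<Longrightarrow> dm_tasks M ! i = \<lparr>wcet = 1, period = 1, deadline = 4 * real M + 2\<rparr>"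
  "\<not> i < M \<Longrightarrow> i < 2 * M \<Longrightarrow>
     dm_tasks M ! i = \<lparr>wcet = 4 * real M - 3, period = \<infinity>, deadline = 4 * real M + 3\<rparr>"
  "dm_tasks M ! (2 * M) = \<lparr>wcet = 4 * real M, period = \<infinity>, deadline = 4 * real M + 4\<rparr>"
  by (auto simp: dm_tasks_def nth_append)

lemma task_system_dm_tasks:
  assumes "M \<ge> 1"
  shows "task_system (dm_tasks M)"
  using assms by (auto simp: task_system_def dm_tasks_def sporadic_task_def utilization_def one_ereal_def)

section \<open>Separation of arrivals, and feasibility at speed 1\<close>

lemma jobs_down_closed:
  assumes "(i, l) \<in> jobs ts J" "k \<le> l"
  shows "(i, k) \<in> jobs ts J"
  using assms by (auto simp: jobs_def elim: le_less_trans[rotated])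

lemma legal_infinite_period:
  assumes "legal s ts J" "(i, k) \<in> jobs ts J" "period (ts ! i) = \<infinity>"
  shows "k = 0"
proof (cases k)
  case (Suc l)
  then have "ereal (arrival J (i, l)) + period (ts ! i) \<le> ereal (arrival J (i, Suc l))"
    using assms unfolding legal_def by blast
  then show ?thesis using assms(3) by simp
qed

lemma legal_separation:
  assumes "legal s ts J" "period (ts ! i) = ereal T" "0 \<le> T" "(i, l) \<in> jobs ts J" "k < l"
  shows "arrival J (i, k) + T \<le> arrival J (i, l)"
  using assms(5,4)
proof (induction l)
  case 0
  then show ?case by simp
next
  case (Suc l)
  have "ereal (arrival J (i, l)) + period (ts ! i) \<le> ereal (arrival J (i, Suc l))"
    using assms(1) Suc.prems(2) unfolding legal_def by blast
  then have "arrival J (i, l) + T \<le> arrival J (i, Suc l)" using assms(2) by simp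
  moreover have "arrival J (i, k) + T \<le> arrival J (i, l)" if "k < l"
    using Suc.IH[OF that] jobs_down_closed[OF Suc.prems(2), of l] by simp
  ultimately show ?case using Suc.prems(1) assms(3) by (cases "k = l") auto
qed

lemma feasible_dm_tasks:
  assumes M: "M \<ge> 1"
  shows "feasible M 1 (dm_tasks M)"
  unfolding feasible_def
proof (intro allI impI)
  fix J
  let ?ts = "dm_tasks M"
  let ?Js = "jobs (dm_tasks M) J"
  let ?a = "arrival J" and ?e = "exec_time J"
  assume legal: "legal 1 ?ts J"
  have job: "0 \<le> ?a j" "0 \<le> ?e j" "?e j \<le> wcet (?ts ! fst j)" if "j \<in> ?Js" for j
    using legal that unfolding legal_def by (cases j; fastforce)+
  have idx: "fst j \<le> 2 * M" if "j \<in> ?Js" for j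
    using that by (auto simp: jobs_def)
  have zero: "snd j = 0" if "j \<in> ?Js" "\<not> fst j < M" for j
  proof (rule legal_infinite_period[OF legal, of "fst j"])
    show "period (?ts ! fst j) = \<infinity>"
      using that idx[OF that(1)] by (cases "fst j = 2 * M") (auto simp: nth_dm_tasks)
  qed (use that in auto)
  have sep: "?a (i, k) + 1 \<le> ?a (i, l)" if "i < M" "(i, l) \<in> ?Js" "k < l" for i k l
    by (rule legal_separation[OF legal _ _ that(2,3)]) (simp_all add: nth_dm_tasks that(1) one_ereal_def)

  \<comment> \<open>Processor \<open>p\<close> runs a slice of length 4 of the last job undisturbed, then task \<open>M + p\<close> in the remaining
    time, then task \<open>p\<close> in what is still left. The first two block task \<open>p\<close> for at most \<open>4 M + 1\<close> in total.\<close>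
  define b where "b = (if (2 * M, 0) \<in> ?Js then ?a (2 * M, 0) else 0)"
  define I where "I p = {b + 4 * real p ..< b + 4 * real p + 4}" for p
  define X where "X p = (if (M + p, 0) \<in> ?Js then window ({0..} - I p) (?a (M + p, 0)) (?e (M + p, 0)) else {})" for p
  define A where "A j = (if fst j < M then {0..} - I (fst j) - X (fst j)
      else if fst j < 2 * M then {0..} - I (fst j - M) else {0..})" for j :: job
  define on where "on p t j \<longleftrightarrow> (if fst j < M then p = fst j else if fst j < 2 * M then p = fst j - M
      else t \<in> I p)" for p and t :: real and j :: job
  have b: "0 \<le> b" using job(1) by (simp add: b_def)
  have I: "I p \<in> sets lebesgue" "I p \<subseteq> {0..}" for p using b by (auto simp: I_def)
  have X: "X p \<in> sets lebesgue" "X p \<subseteq> {0..} - I p" for p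
    using I job by (auto simp: X_def intro!: sets_window) (auto simp: window_def)
  have cI: "{0..} - I p \<in> sets lebesgue" for p using I by (intro sets.Diff) auto
  then have A: "A j \<in> sets lebesgue" for j
    unfolding A_def by (simp only: sets.Diff X(1) split: if_split) simp
  have A_nonneg: "A j \<subseteq> {0..}" for j by (auto simp: A_def)
  have I_unique: "p = q" if "t \<in> I p" "t \<in> I q" for p q t
    using that by (auto simp: I_def)
  have avail_I: "avail (I p) t \<le> 4" for p t
    using avail_interval_le[of "b + 4 * real p" "b + 4 * real p + 4" t] by (simp add: I_def)
  have avail_I': "avail ({0..} - I p) t \<ge> t - 4" if "0 \<le> t" for p t
    using avail_I[of p t] I that by (simp add: avail_diff avail_UNIV)
  have avail_X: "avail (X p) t \<le> 4 * real M - 3" if "0 \<le> t" "p < M" for p t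
  proof (cases "(M + p, 0) \<in> ?Js")
    case True
    then have "avail (X p) t \<le> ?e (M + p, 0)"
      unfolding X_def using job[OF True] I that by (auto intro!: avail_window_le)
    then show ?thesis using job(3)[OF True] that by (simp add: nth_dm_tasks)
  next
    case False
    then show ?thesis using M by (simp add: X_def avail_def)
  qed

  define R where "R p t j \<longleftrightarrow> j \<in> ?Js \<and> t \<in> window (A j) (?a j) (?e j) \<and> on p t j" for p t j
  have R_unique: "j = j'" if "R p t j" "R p t j'" for p t j j'
  proof -
    \<comment> \<open>Processor and time determine the task: the slice of the last job comes first,
      then the single job, then the periodic task. Jobs of the same task are separated
      afterwards.\<close>
    have task: "fst j = (if t \<in> I p then 2 * M else if t \<in> X p then M + p else p)"
      if j: "j \<in> ?Js" "t \<in> window (A j) (?a j) (?e j)" "on p t j" for j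
    proof -
      have t: "t \<in> A j" using j(2) by (simp add: window_def)
      consider "fst j < M" | "\<not> fst j < M" "fst j < 2 * M" | "fst j = 2 * M" using idx[OF j(1)] by linarith
      then show ?thesis
      proof cases
        case 1
        then show ?thesis using t j(3) by (simp add: A_def on_def)
      next
        case 2
        then have p: "j = (M + p, 0)" using zero[OF j(1)] j(3) by (simp add: on_def prod_eq_iff)
        then have "t \<in> X p" using 2 j(1,2) by (simp add: A_def X_def)
        then show ?thesis using X(2)[of p] p by auto
      next
        case 3
        then show ?thesis using j(3) M by (simp add: on_def)
      qed
    qed
    have "fst j = fst j'" using task[of j] task[of j'] that by (simp add: R_def)
    then consider "fst j < M" "fst j = fst j'" | "\<not> fst j < M" "fst j = fst j'" by blast
    then show ?thesis
    proof cases
      case 1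
      obtain i k l where ij: "j = (i, k)" "j' = (i, l)" "i < M"
        using 1 by (cases j; cases j') simp
      \<comment> \<open>Both jobs use the same clock and have windows of length at most 1, so a
        common reading forces arrivals less than 1 apart, which contradicts the period.\<close>
      have "A (i, l) = A (i, k)" by (simp add: A_def)
      then have "?a j \<le> avail (A j) t" "avail (A j) t < ?a j + 1"
          "?a j' \<le> avail (A j) t" "avail (A j) t < ?a j' + 1"
        using that job(3)[of j] job(3)[of j'] unfolding R_def ij
        by (simp_all add: window_def nth_dm_tasks ij)
      then have close: "?a (i, k) < ?a (i, l) + 1" "?a (i, l) < ?a (i, k) + 1" by (simp_all add: ij)
      have "(i, k) \<in> ?Js" "(i, l) \<in> ?Js" using that by (simp_all add: R_def ij)
      then show ?thesis
        using sep[of i k l] sep[of i l k] close ij by (cases k l rule: linorder_cases) auto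
    next
      case 2
      then show ?thesis using zero[of j] zero[of j'] that by (auto simp: R_def prod_eq_iff)
    qed
  qed
  obtain \<sigma> :: schedule where \<sigma>: "\<And>p t j. \<sigma> p t = Some j \<longleftrightarrow> R p t j"
    using schedule_of_relation[of R] R_unique by blast
  have on_ex: "\<exists>p<M. on p t j" if j: "j \<in> ?Js" "t \<in> window (A j) (?a j) (?e j)" for t j
  proof -
    consider "fst j < M" | "\<not> fst j < M" "fst j < 2 * M" | "fst j = 2 * M" using idx[OF j(1)] by linarith
    then show ?thesis
    proof cases
      case 3
      then have "j = (2 * M, 0)" using zero[OF j(1)] by (cases j) auto
      then have "?a j = b" using j(1) by (simp add: b_def)
      moreover have "A j = {0..}" using 3 by (simp add: A_def)
      ultimately have t: "b \<le> t" "t < b + ?e j" using j(2) b by (auto simp: window_UNIV)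
      have "t < b + 4 * real M" using t job(3)[OF j(1)] by (simp add: 3 nth_dm_tasks)
      \<comment> \<open>Slices have length 4, so this is the index of the slice containing
        \<open>t\<close>; the bound \<open>4 * M\<close> on the execution time keeps it below
        \<open>M\<close>.\<close>
      define p where "p = nat \<lfloor>(t - b) / 4\<rfloor>"
      have p: "real p \<le> (t - b) / 4" "(t - b) / 4 < real p + 1"
        using t(1) of_int_floor_le[of "(t - b) / 4"] unfolding p_def by (simp_all del: of_int_floor_le)
      have "real p < real M" using p(1) \<open>t < b + 4 * real M\<close> by simp
      then have "p < M" by simp
      moreover have "t \<in> I p" using p by (simp add: I_def)
      ultimately show ?thesis using 3 M by (auto simp: on_def)
    qed (auto simp: on_def)
  qed
  interpret window_schedule M ?ts J \<sigma> A ?a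
  proof
    fix t :: real
    show "executing M \<sigma> t = {j \<in> ?Js. t \<in> window (A j) (?a j) (?e j)}"
      using on_ex unfolding executing_def \<sigma> R_def by blast
  next
    fix t p q i k l
    assume "\<sigma> p t = Some (i, k)" "\<sigma> q t = Some (i, l)"
    \<comment> \<open>Only the last job migrates, and its slices are disjoint.\<close>
    then show "p = q" using I_unique unfolding \<sigma> R_def on_def by (auto split: if_splits)
  qed (use A A_nonneg job in auto)
  have "?e j \<le> service M \<sigma> j (?a j + deadline (?ts ! fst j))" if j: "j \<in> ?Js" for j
  proof -
    let ?d = "?a j + deadline (?ts ! fst j)"
    \<comment> \<open>It suffices that the clock of the job reaches the end of its window by the
      deadline. For a periodic task, 4 for the slice, \<open>4 * M - 3\<close> for the single job
      and 1 for its own execution add up exactly to the deadline \<open>4 * M + 2\<close>.\<close>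
    have "?a j + ?e j \<le> avail (A j) ?d \<and> 0 \<le> ?d"
    proof -
      consider "fst j < M" | "\<not> fst j < M" "fst j < 2 * M" | "fst j = 2 * M" using idx[OF j] by linarith
      then show ?thesis
      proof cases
        case 1
        then have d: "?d = ?a j + (4 * real M + 2)" and e: "?e j \<le> 1"
          using job[OF j] by (simp_all add: nth_dm_tasks)
        have "avail (A j) ?d = avail ({0..} - I (fst j)) ?d - avail (X (fst j)) ?d"
          using 1 avail_diff[OF cI X] by (simp add: A_def)
        then show ?thesis using avail_I'[of ?d "fst j"] avail_X[of ?d "fst j"] 1 d e job[OF j] by simp
      next
        case 2
        then show ?thesis using avail_I'[of ?d "fst j - M"] job[OF j] by (simp add: A_def nth_dm_tasks)
      next
        case 3
        then show ?thesis using job[OF j] by (simp add: A_def nth_dm_tasks avail_UNIV)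
      qed
    qed
    then show ?thesis using service_eq[OF j, of ?d] job[OF j] by simp
  qed
  then have "meets_deadlines M ?ts J \<sigma>" unfolding meets_deadlines_def by auto
  then show "\<exists>\<sigma>. valid_schedule M ?ts J \<sigma> \<and> meets_deadlines M ?ts J \<sigma>" using valid by blast
qed

section \<open>A deadline miss under global DM below the critical speed\<close>

lemma dm_misses_deadline:
  assumes M: "M \<ge> 1" and "dm_priorities \<pi>" and s: "0 < s" "s < 3 * real M / (real M + 1)"
  shows "\<exists>J \<sigma>. legal s (dm_tasks M) J \<and> global_fp \<pi> M (dm_tasks M) J \<sigma> \<and> \<not> meets_deadlines M (dm_tasks M) J \<sigma>"
proof -
  let ?ts = "dm_tasks M"
  \<comment> \<open>Execution times are those for the critical speed \<open>1 / r\<close>, and thus legal for every smaller speed.\<close>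
  define r where "r = (real M + 1) / (3 * real M)"
  have r: "0 < r" "r \<le> 1" using M by (simp_all add: r_def)
  have rs: "r \<le> 1 / s" using s M by (simp add: r_def field_simps)
  define J where "J = \<lparr>num_jobs = \<lambda>i. if i < M then \<infinity> else 1, arrival = \<lambda>(i, k). real k,
      exec_time = \<lambda>(i, k). wcet (?ts ! i) * r\<rparr>"
  let ?Js = "jobs ?ts J"
  have Js: "(i, k) \<in> ?Js \<longleftrightarrow> i < M \<or> i < 2 * M + 1 \<and> k = 0" for i k
    by (auto simp: jobs_def J_def one_enat_def)
  have J_simps: "arrival J (i, k) = real k" "exec_time J (i, k) = wcet (?ts ! i) * r" for i k
    by (simp_all add: J_def)
  have wcet: "0 < wcet (?ts ! i)" if "i < 2 * M + 1" for i
    using that task_system_dm_tasks[OF M] by (auto simp: task_system_def sporadic_task_def)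
  have legal: "legal s ?ts J"
    unfolding legal_def
  proof (intro conjI ballI allI impI)
    fix j assume "j \<in> ?Js"
    then show "case j of (i, k) \<Rightarrow> 0 \<le> arrival J (i, k) \<and> 0 \<le> exec_time J (i, k) \<and>
        exec_time J (i, k) \<le> wcet (?ts ! i) / s"
      using wcet[of "fst j"] r mult_left_mono[OF rs, of "wcet (?ts ! fst j)"]
      by (cases j) (auto simp: J_simps jobs_def)
  next
    fix i k assume "(i, Suc k) \<in> ?Js"
    then have "i < M" by (simp add: Js)
    then show "ereal (arrival J (i, k)) + period (?ts ! i) \<le> ereal (arrival J (i, Suc k))"
      by (simp add: J_simps nth_dm_tasks one_ereal_def)
  qed

  \<comment> \<open>The gaps that the synchronous periodic jobs leave on all processors at
    once.\<close>
  define G where "G = {0..} - (\<Union>k. {real k..<real k + r})"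
  define e1 where "e1 = (4 * real M - 3) * r"
  define e2 where "e2 = 4 * real M * r"
  have e: "0 < e1" "0 < e2" using M r by (simp_all add: e1_def e2_def)
  have G: "G \<in> sets lebesgue" "G \<subseteq> {0..}" by (auto simp: G_def)
  have avail_G: "avail G (real n) \<le> real n * (1 - r)" for n
  proof (induction n)
    case (Suc n)
    have "G \<inter> {real n..<real (Suc n)} \<subseteq> {real n + r..<real (Suc n)}" by (auto simp: G_def not_less)
    then have "measure lebesgue (G \<inter> {real n..<real (Suc n)}) \<le> measure lebesgue {real n + r..<real (Suc n)}"
      by (intro measure_mono_fmeasurable)
        (use G in \<open>auto intro: bounded_set_imp_lmeasurable fmeasurableD lmeasurable_Int_interval\<close>)
    then show ?case using Suc r avail_split[OF G(1), of "real n" "real (Suc n)"] by (simp add: algebra_simps)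
  qed simp
  have not_G: "t \<notin> G \<longleftrightarrow> (\<exists>k. real k \<le> t \<and> t < real k + r)" if "0 \<le> t" for t
    using that by (auto simp: G_def)
  have stream_unique: "k = l" if "real k \<le> t" "t < real k + r" "real l \<le> t" "t < real l + r" for k l t
    using that r by linarith

  define A where "A j = (if fst j < M then {0..} else G)" for j :: job
  \<comment> \<open>On the clock of \<open>G\<close>, the \<open>M\<close> single jobs run in
    parallel from reading 0 to \<open>e1\<close>. The last job follows from \<open>e1\<close> on,
    when processor 0 is free in every gap.\<close>
  define start where "start j = (if fst j < M then real (snd j) else if fst j < 2 * M then 0 else e1)" for j :: job
  define on where "on p j \<longleftrightarrow> p = (if fst j < M then fst j else if fst j < 2 * M then fst j - M else 0)"
    for p and j :: job
  let ?W = "\<lambda>j. window (A j) (start j) (exec_time J j)"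
  have W: "t \<in> ?W (i, k) \<longleftrightarrow>
      (if i < M then real k \<le> t \<and> t < real k + r
       else if i < 2 * M then t \<in> G \<and> avail G t < e1
       else t \<in> G \<and> e1 \<le> avail G t \<and> avail G t < e1 + e2)" if "(i, k) \<in> ?Js" for i k t
  proof -
    have "window {0..} (real k) r = {real k..<real k + r}" by (simp add: window_UNIV)
    moreover have "i = 2 * M" if "\<not> i < 2 * M" using that \<open>(i, k) \<in> ?Js\<close> by (auto simp: Js)
    ultimately show ?thesis
      by (auto simp: A_def start_def J_simps nth_dm_tasks e1_def e2_def) (auto simp: window_def)
  qed
  define R where "R p t j \<longleftrightarrow> j \<in> ?Js \<and> t \<in> ?W j \<and> on p j" for p t j
  have R_unique: "j = j'" if "R p t j" "R p t j'" for p t j j'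
  proof -
    obtain i k i' k' where j: "j = (i, k)" "j' = (i', k')" by (cases j; cases j') blast
    have tG: "t \<in> G \<Longrightarrow> \<not> (real k \<le> t \<and> t < real k + r)" for k
      by (auto simp: G_def)
    show ?thesis
      using that tG[of k] tG[of k'] stream_unique[of k t k'] unfolding R_def on_def j
      by (auto simp: W Js split: if_splits)
  qed
  obtain \<sigma> :: schedule where \<sigma>: "\<And>p t j. \<sigma> p t = Some j \<longleftrightarrow> R p t j"
    using schedule_of_relation[of R] R_unique by blast
  have on_ex: "\<exists>p<M. on p j" if "j \<in> ?Js" for j
    using that M by (cases j) (auto simp: on_def Js)
  interpret window_schedule M ?ts J \<sigma> A start
  proof
    fix t :: real
    show "executing M \<sigma> t = {j \<in> ?Js. t \<in> ?W j}"
      using on_ex unfolding executing_def \<sigma> R_def by blast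
  next
    fix j assume j: "j \<in> ?Js"
    show "0 \<le> exec_time J j"
      using j wcet[of "fst j"] r by (cases j) (auto simp: J_simps jobs_def)
    show "arrival J j \<le> start j"
      using j e by (cases j) (auto simp: J_simps start_def Js)
    show "0 \<le> start j" using e by (simp add: start_def)
    show "A j \<in> sets lebesgue" "A j \<subseteq> {0..}" using G by (auto simp: A_def)
  next
    fix t p q i k l
    assume "\<sigma> p t = Some (i, k)" "\<sigma> q t = Some (i, l)"
    then show "p = q" unfolding \<sigma> R_def on_def by auto
  qed

  \<comment> \<open>The three groups have strictly increasing deadlines, so any tie-breaking rule
    orders them alike; the order within a group is left open.\<close>
  have \<pi>: "\<pi> ?ts i < \<pi> ?ts j" if "i < 2 * M" "j < 2 * M + 1" "i < M \<and> \<not> j < M \<or> \<not> i < M \<and> \<not> j < 2 * M" for i j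
  proof -
    have "deadline (?ts ! i) < deadline (?ts ! j)"
      using that by (cases "j = 2 * M"; cases "i < M") (auto simp: nth_dm_tasks)
    then show ?thesis using assms(2) that unfolding dm_priorities_def by auto
  qed

  have "executing M \<sigma> t =
        {(i, k). i \<in> active_tasks M ?ts J \<sigma> t \<and>
           card {h \<in> active_tasks M ?ts J \<sigma> t. \<pi> ?ts h < \<pi> ?ts i} < M \<and>
           k = (LEAST l. (i, l) \<in> pending M ?ts J \<sigma> t)}" if t: "0 \<le> t" for t
  proof -
    let ?P = "pending M ?ts J \<sigma> t" and ?act = "active_tasks M ?ts J \<sigma> t"
    have P: "(i, k) \<in> ?P \<longleftrightarrow>
      (if i < M then real k \<le> t \<and> t < real k + r
       else k = 0 \<and> (i < 2 * M \<and> avail G t < e1 \<or> i = 2 * M \<and> avail G t < e1 + e2))" for i k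
    proof (cases "i < 2 * M")
      case True
      then show ?thesis unfolding pending_eq[OF t] using r e M t
        by (auto simp: Js J_simps A_def start_def nth_dm_tasks avail_UNIV e1_def)
    next
      case False
      then show ?thesis unfolding pending_eq[OF t] using r e t
        by (cases "i = 2 * M") (auto simp: Js J_simps A_def start_def nth_dm_tasks e2_def)
    qed
    have P_unique: "k = l" if "(i, k) \<in> ?P" "(i, l) \<in> ?P" for i k l
      using that stream_unique[of k t l] by (auto simp: P split: if_splits)
    have act: "?act = (if t \<in> G then {} else {..<M}) \<union> (if avail G t < e1 then {M..<2 * M} else {}) \<union>
        (if avail G t < e1 + e2 then {2 * M} else {})"
    proof (rule set_eqI)
      fix i
      have "i \<in> ?act \<longleftrightarrow> (\<exists>k. (i, k) \<in> ?P)" by (force simp: active_tasks_def)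
      then show "i \<in> ?act \<longleftrightarrow> i \<in> (if t \<in> G then {} else {..<M}) \<union> (if avail G t < e1 then {M..<2 * M} else {}) \<union>
        (if avail G t < e1 + e2 then {2 * M} else {})"
        using not_G[OF t] M unfolding P by auto
    qed
    \<comment> \<open>No task ever has two pending jobs, since a periodic job is finished within its
      period; the earliest pending job is the only one.\<close>
    have least: "i \<in> ?act \<and> k = (LEAST l. (i, l) \<in> ?P) \<longleftrightarrow> (i, k) \<in> ?P" for i k
    proof
      assume "i \<in> ?act \<and> k = (LEAST l. (i, l) \<in> ?P)"
      then show "(i, k) \<in> ?P" by (auto simp: active_tasks_def intro: LeastI)
    next
      assume k: "(i, k) \<in> ?P"
      then have "(LEAST l. (i, l) \<in> ?P) = k" by (metis LeastI P_unique)
      then show "i \<in> ?act \<and> k = (LEAST l. (i, l) \<in> ?P)" using k by (force simp: active_tasks_def)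
    qed
    \<comment> \<open>Outside \<open>G\<close> the periodic tasks form the top group of size
      \<open>M\<close>; in \<open>G\<close> before reading \<open>e1\<close> the single jobs do.
      Afterwards at most the last task is active in \<open>G\<close>, and nothing outranks
      it.\<close>
    have top: "card {h \<in> ?act. \<pi> ?ts h < \<pi> ?ts i} < M \<longleftrightarrow>
        (if t \<notin> G then i < M else if avail G t < e1 then i < 2 * M else True)" if i: "i \<in> ?act" for i
    proof -
      consider "t \<notin> G" | "t \<in> G" "avail G t < e1" | "t \<in> G" "\<not> avail G t < e1" by blast
      then show ?thesis
      proof cases
        case 1
        define L where "L = ?act - {..<M}"
        have "?act = {..<M} \<union> L" using 1 by (auto simp: L_def act)
        moreover have "finite L" "\<And>h l. h \<in> {..<M} \<Longrightarrow> l \<in> L \<Longrightarrow> \<pi> ?ts h < \<pi> ?ts l"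
          by (auto simp: L_def act intro!: \<pi> split: if_splits)
        ultimately show ?thesis using card_higher_less_iff[of "{..<M}" M L "\<pi> ?ts" i] i 1 by auto
      next
        case 2
        then have act2: "?act = {M..<2 * M} \<union> {2 * M}" using e by (auto simp: act)
        have "card {h \<in> {M..<2 * M} \<union> {2 * M}. \<pi> ?ts h < \<pi> ?ts i} < M \<longleftrightarrow> i \<in> {M..<2 * M}"
          by (rule card_higher_less_iff) (use i act2 in \<open>auto intro!: \<pi>\<close>)
        then show ?thesis using 2 i unfolding act2 by auto
      next
        case 3
        then have "?act \<subseteq> {2 * M}" by (auto simp: act)
        then have "{h \<in> ?act. \<pi> ?ts h < \<pi> ?ts i} = {}" using i by auto
        then show ?thesis using 3 M by (metis card.empty less_le_trans zero_less_one)
      qed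
    qed
    have "(i, k) \<in> executing M \<sigma> t \<longleftrightarrow> (i, k) \<in> ?P \<and>
        (if t \<notin> G then i < M else if avail G t < e1 then i < 2 * M else True)" for i k
    proof (cases "(i, k) \<in> ?Js")
      case True
      then show ?thesis using not_G[OF t] unfolding executing_eq[OF t]
        by (auto simp: W P Js split: if_splits)
    next
      case False
      then show ?thesis by (auto simp: executing_eq[OF t] pending_def)
    qed
    then have "(i, k) \<in> executing M \<sigma> t \<longleftrightarrow> i \<in> ?act \<and> card {h \<in> ?act. \<pi> ?ts h < \<pi> ?ts i} < M \<and>
        k = (LEAST l. (i, l) \<in> ?P)" for i k
      using least[of i k] top[of i] by blast
    then show ?thesis by auto
  qed
  then have fp: "global_fp \<pi> M ?ts J \<sigma>" using valid unfolding global_fp_def by blast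

  let ?d = "real (4 * M + 4)"
  have last: "(2 * M, 0) \<in> ?Js" by (simp add: Js)
  \<comment> \<open>Since \<open>4 * M + 4 = 12 * M * r\<close>, the gap time before the deadline is
    at most \<open>(8 * M - 4) * r\<close>, whereas \<open>e1 + e2 = (8 * M - 3) * r\<close>: the
    last job lacks at least \<open>r\<close>.\<close>
  have "real M * r = (real M + 1) / 3" using M by (simp add: r_def)
  then have "?d * (1 - r) < e1 + e2" using r by (simp add: e1_def e2_def algebra_simps)
  then have "avail G ?d < e1 + e2" using avail_G[of "4 * M + 4"] by linarith
  then have "service M \<sigma> (2 * M, 0) ?d < e2"
    using service_eq[OF last, of ?d] e by (simp add: A_def start_def J_simps nth_dm_tasks e2_def min_def split: if_splits)
  moreover have "exec_time J (2 * M, 0) = e2" "arrival J (2 * M, 0) = 0" "deadline (?ts ! (2 * M)) = ?d"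
    by (simp_all add: J_simps nth_dm_tasks e2_def)
  ultimately have "\<not> meets_deadlines M ?ts J \<sigma>"
    using last unfolding meets_deadlines_def by fastforce
  then show ?thesis using legal fp by blast
qed

theorem theorem5p4:
  fixes M :: nat and \<pi> :: "task list \<Rightarrow> nat \<Rightarrow> nat" and s :: real
  assumes "M \<ge> 2"
    and "dm_priorities \<pi>"
    and "s > 0"
    and "speedup_bound M (global_fp \<pi>) s"
  shows "s \<ge> 3 - 3 / (real M + 1)"
proof (rule ccontr)
  assume "\<not> s \<ge> 3 - 3 / (real M + 1)"
  then have "s < 3 * real M / (real M + 1)" by (simp add: field_simps)
  then obtain J \<sigma> where "legal s (dm_tasks M) J" "global_fp \<pi> M (dm_tasks M) J \<sigma>"
      "\<not> meets_deadlines M (dm_tasks M) J \<sigma>"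
    using dm_misses_deadline[of M \<pi> s] assms by auto
  then show False
    using assms(1,4) task_system_dm_tasks[of M] feasible_dm_tasks[of M] unfolding speedup_bound_def by auto
qed

end
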